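(* Let $(\mathcal X,\mathcal F)$ be a measurable space and $P$ the Markov kernel of a $\phi$-irreducible Markov chain on $\mathcal X$ with stationary distribution $\pi$ and time-reversal $P^*$. Assume that $P(x,\cdot)$, $P^*(x,\cdot)$ ($x\in\mathcal X$) and $\pi$ are absolutely continuous with respect to a common reference measure $\mu$ on $(\mathcal X,\mathcal F)$, with densities $p(x,\cdot)$, $p^*(x,\cdot)$, $\pi(\cdot)$, and that $\{x:\pi(x)=0\}$ is a $\mu$-null set. Let $M_1,M_2$ be the first and second Metropolis-Hastings (MH) kernels of $P$, with spectral measures $\mathcal E_1,\mathcal E_2$ as self-adjoint operators on $L^2(\pi)$. For $x\in\mathcal X$ put $A_x:=\{y\in\mathcal X:\alpha_1(x,y)<1\}$, where $\alpha_1(x,y)=\min\left(\frac{\pi(y)p(y,x)}{\pi(x)p(x,y)},1\right)$ if $\pi(x)p(x,y)>0$ and $\alpha_1(x,y)=0$ otherwise. Then for $x\in\mathcal X$ and $B\in\mathcal F$ with $x\notin B$, $$P(x,B)=\int_{\sigma(M_1)}\lambda\,\delta_x\mathcal E_1(d\lambda)(B\cap A_x^c)+\int_{\sigma(M_2)}\lambda\,\delta_x\mathcal E_2(d\lambda)(B\cap A_x),$$ $$P(x,\{x\})=\frac12\left(\int_{\sigma(M_1)}\lambda\,\delta_x\mathcal E_1(d\lambda)(\{x\})+\int_{\sigma(M_2)}\lambda\,\delta_x\mathcal E_2(d\lambda)(\{x\})\right),$$ $$P^*(x,B)=\int_{\sigma(M_1)}\lambda\,\delta_x\mathcal E_1(d\lambda)(B\cap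 A_x)+\int_{\sigma(M_2)}\lambda\,\delta_x\mathcal E_2(d\lambda)(B\cap A_x^c).$$
   Context: $L^2(\pi)$ is the complex Hilbert space with $\langle f,g\rangle_\pi=\int f\overline g\,d\pi$. Kernels act by $Kf(x)=\int f(y)K(x,dy)$ and $\nu K(A)=\int K(x,A)\nu(dx)$. The time-reversal $P^*$ is the adjoint of $P$ on $L^2(\pi)$: $\pi(dx)P^*(x,dy)=\pi(dy)P(y,dx)$. MH kernels: with $\alpha_1$ as in the claim and $r_1(x)=\int_{y\ne x}(1-\alpha_1(x,y))p(x,y)\,\mu(dy)$, $$M_1(x,dy)=\min\{p(x,y),p^*(x,y)\}\mu(dy)+r_1(x)\delta_x(dy),\qquad M_2(x,dy)=\max\{p(x,y),p^*(x,y)\}\mu(dy)-r_1(x)\delta_x(dy),$$ where $\alpha_1(x,y)p(x,y)=\min\{p(x,y),p^*(x,y)\}$. Both are self-adjoint on $L^2(\pi)$, and $M_i=\int_{\sigma(M_i)}\lambda\,\mathcal E_i(d\lambda)$ by the spectral theorem, where $\sigma(M_i)$ is the spectrum of $M_i$ on $L^2(\pi)$. Notation: $\delta_x$ is the point mass at $x$; for $C\in\mathcal F$, $\int_{\sigma(M_i)}\lambda\,\delta_x\mathcal E_i(d\lambda)(C)$ denotes the value at $x$ of $\left(\int_{\sigma(M_i)}\lambda\,\mathcal E_i(d\lambda)\right)\mathbf 1_C=M_i\mathbf 1_C$, the version being the one given by the kernel, i.e. $\delta_xM_i(C)=M_i(x,C)$.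
   Formalization: Where π(x)p(x,y)=0, α_1(x,y) is set to 1 instead of 0, since with 0 the first and third identities fail (e.g. rotation of three points); α_1 p = min{p,p*} is required for every x and μ-a.e. y, singletons are measurable, and p, p* are jointly measurable. *)

theory Defs
  imports "HOL-Probability.Probability"
begin

section \<open>Markov kernels\<close>

primrec kernel_pow :: "'a measure \<Rightarrow> ('a \<Rightarrow> 'a measure) \<Rightarrow> nat \<Rightarrow> 'a \<Rightarrow> 'a measure" where
  "kernel_pow M P 0 = return M"
| "kernel_pow M P (Suc n) = (\<lambda>x. P x \<bind> kernel_pow M P n)"

definition phi_irreducible :: "'a measure \<Rightarrow> ('a \<Rightarrow> 'a measure) \<Rightarrow> bool" where
  "phi_irreducible M P \<longleftrightarrow>
     (\<exists>\<phi>. sets \<phi> = sets M \<and> sigma_finite_measure \<phi> \<and> emeasure \<phi> (space M) \<noteq> 0 \<and>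
       (\<forall>A\<in>sets M. emeasure \<phi> A > 0 \<longrightarrow>
          (\<forall>x\<in>space M. \<exists>n\<ge>1. emeasure (kernel_pow M P n x) A > 0)))"

text \<open>\<open>\<pi>(dx) P\<^sup>*(x,dy) = \<pi>(dy) P(y,dx)\<close>, tested on measurable rectangles.\<close>

definition time_reversal :: "'a measure \<Rightarrow> ('a \<Rightarrow> 'a measure) \<Rightarrow> ('a \<Rightarrow> 'a measure) \<Rightarrow> bool" where
  "time_reversal \<pi> P Ps \<longleftrightarrow>
     (\<forall>A\<in>sets \<pi>. \<forall>B\<in>sets \<pi>.
        (\<integral>\<^sup>+x\<in>A. emeasure (Ps x) B \<partial>\<pi>) = (\<integral>\<^sup>+y\<in>B. emeasure (P y) A \<partial>\<pi>))"

section \<open>The complex Hilbert space $L^2$ and its bounded operators\<close>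

text \<open>Elements of $L^2$ are represented by square-integrable functions. Equality in $L^2$ is
  equality almost everywhere, and an operator is a map on representatives.\<close>

definition L2 :: "'a measure \<Rightarrow> ('a \<Rightarrow> complex) set" where
  "L2 M = {f \<in> borel_measurable M. integrable M (\<lambda>x. (cmod (f x))\<^sup>2)}"

definition L2_inner :: "'a measure \<Rightarrow> ('a \<Rightarrow> complex) \<Rightarrow> ('a \<Rightarrow> complex) \<Rightarrow> complex" where
  "L2_inner M f g = (\<integral>x. f x * cnj (g x) \<partial>M)"

definition L2_norm :: "'a measure \<Rightarrow> ('a \<Rightarrow> complex) \<Rightarrow> real" where
  "L2_norm M f = sqrt (\<integral>x. (cmod (f x))\<^sup>2 \<partial>M)"

type_synonym 'a op = "('a \<Rightarrow> complex) \<Rightarrow> ('a \<Rightarrow> complex)"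

text \<open>Linearity (almost everywhere) and boundedness together imply that \<open>T\<close> maps almost
  everywhere equal representatives to almost everywhere equal ones.\<close>

definition bounded_op :: "'a measure \<Rightarrow> 'a op \<Rightarrow> bool" where
  "bounded_op M T \<longleftrightarrow>
     (\<forall>f\<in>L2 M. T f \<in> L2 M) \<and>
     (\<forall>f\<in>L2 M. \<forall>g\<in>L2 M. \<forall>a. AE x in M. T (\<lambda>y. a * f y + g y) x = a * T f x + T g x) \<and>
     (\<exists>C. \<forall>f\<in>L2 M. L2_norm M (T f) \<le> C * L2_norm M f)"

definition op_eq :: "'a measure \<Rightarrow> 'a op \<Rightarrow> 'a op \<Rightarrow> bool" where
  "op_eq M S T \<longleftrightarrow> (\<forall>f\<in>L2 M. AE x in M. S f x = T f x)"

definition op_shift :: "'a op \<Rightarrow> complex \<Rightarrow> 'a op" where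
  "op_shift T z = (\<lambda>f x. T f x - z * f x)"

definition L2_spectrum :: "'a measure \<Rightarrow> 'a op \<Rightarrow> complex set" where
  "L2_spectrum M T =
     {z. \<not> (\<exists>R. bounded_op M R \<and> op_eq M (R \<circ> op_shift T z) id \<and> op_eq M (op_shift T z \<circ> R) id)}"

section \<open>Spectral measures\<close>

definition orthogonal_projection :: "'a measure \<Rightarrow> 'a op \<Rightarrow> bool" where
  "orthogonal_projection M Q \<longleftrightarrow>
     bounded_op M Q \<and> op_eq M (Q \<circ> Q) Q \<and>
     (\<forall>f\<in>L2 M. \<forall>g\<in>L2 M. L2_inner M (Q f) g = L2_inner M f (Q g))"

definition projection_valued_measure :: "'a measure \<Rightarrow> (complex set \<Rightarrow> 'a op) \<Rightarrow> bool" where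
  "projection_valued_measure M E \<longleftrightarrow>
     (\<forall>S\<in>sets borel. orthogonal_projection M (E S)) \<and>
     op_eq M (E UNIV) id \<and>
     (\<forall>S\<in>sets borel. \<forall>T\<in>sets borel. op_eq M (E (S \<inter> T)) (E S \<circ> E T)) \<and>
     (\<forall>A f g. range A \<subseteq> sets borel \<longrightarrow> disjoint_family A \<longrightarrow> f \<in> L2 M \<longrightarrow> g \<in> L2 M \<longrightarrow>
        (\<lambda>i::nat. L2_inner M (E (A i) f) g) sums L2_inner M (E (\<Union>i. A i) f) g)"

definition spectral_scalar_measure ::
  "'a measure \<Rightarrow> (complex set \<Rightarrow> 'a op) \<Rightarrow> ('a \<Rightarrow> complex) \<Rightarrow> complex measure" where
  "spectral_scalar_measure M E f =
     measure_of UNIV (sets borel) (\<lambda>S. ennreal (Re (L2_inner M (E S f) f)))"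

text \<open>\<open>T\<close> is the operator $\int_S \lambda\,E(d\lambda)$: a bounded operator with
  $\langle Tf,f\rangle = \int_S \lambda\,\langle E(d\lambda)f,f\rangle$ for all \<open>f\<close>. By
  polarization this determines \<open>T\<close> up to almost everywhere equality.\<close>

definition is_spectral_integral ::
  "'a measure \<Rightarrow> (complex set \<Rightarrow> 'a op) \<Rightarrow> complex set \<Rightarrow> 'a op \<Rightarrow> bool" where
  "is_spectral_integral M E S T \<longleftrightarrow>
     bounded_op M T \<and>
     (\<forall>f\<in>L2 M. set_integrable (spectral_scalar_measure M E f) S (\<lambda>z. z) \<and>
        L2_inner M (T f) f = (LINT z:S|spectral_scalar_measure M E f. z))"

definition spectral_integral ::
  "'a measure \<Rightarrow> (complex set \<Rightarrow> 'a op) \<Rightarrow> complex set \<Rightarrow> 'a op" where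
  "spectral_integral M E S = (SOME T. is_spectral_integral M E S T)"

text \<open>For self-adjoint \<open>T\<close> the spectrum is real, so the projection-valued measure, defined here
  on the Borel sets of the complex plane, is concentrated on the real line.\<close>

definition spectral_measure_of :: "'a measure \<Rightarrow> 'a op \<Rightarrow> (complex set \<Rightarrow> 'a op) \<Rightarrow> bool" where
  "spectral_measure_of M T E \<longleftrightarrow>
     projection_valued_measure M E \<and>
     op_eq M (E (L2_spectrum M T)) id \<and>
     is_spectral_integral M E (L2_spectrum M T) T"

text \<open>The value at \<open>x\<close> of $\left(\int_S \lambda\,E(d\lambda)\right) 1_C$, computed with the
  version \<open>y \<mapsto> K y C\<close> given by the kernel \<open>K\<close>. It is unspecified when \<open>y \<mapsto> K y C\<close> is not a
  version of that element of $L^2$.\<close>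

definition spectral_value ::
  "'a measure \<Rightarrow> (complex set \<Rightarrow> 'a op) \<Rightarrow> complex set \<Rightarrow> ('a \<Rightarrow> 'a set \<Rightarrow> real) \<Rightarrow> 'a \<Rightarrow> 'a set \<Rightarrow> real" where
  "spectral_value M E S K x C =
     (if AE y in M. spectral_integral M E S (indicator C) y = complex_of_real (K y C)
      then K x C else undefined)"

section \<open>Metropolis-Hastings kernels\<close>

text \<open>The signed kernel $K(x,dy) = k(x,y)\,\mu(dy) + c(x)\,\delta_x(dy)$, as a set function and as
  an operator $Kf(x) = \int f(y)\,K(x,dy)$.\<close>

definition density_atom_kernel ::
  "'a measure \<Rightarrow> ('a \<Rightarrow> 'a \<Rightarrow> real) \<Rightarrow> ('a \<Rightarrow> real) \<Rightarrow> 'a \<Rightarrow> 'a set \<Rightarrow> real" where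
  "density_atom_kernel \<mu> k c x C = (LINT y:C|\<mu>. k x y) + c x * indicator C x"

definition density_atom_op ::
  "'a measure \<Rightarrow> ('a \<Rightarrow> 'a \<Rightarrow> real) \<Rightarrow> ('a \<Rightarrow> real) \<Rightarrow> 'a op" where
  "density_atom_op \<mu> k c f x =
     (\<integral>y. f y * complex_of_real (k x y) \<partial>\<mu>) + complex_of_real (c x) * f x"

text \<open>The acceptance probability $\alpha_1$. Where $\pi(x)p(x,y) = 0$ no move from \<open>x\<close> to \<open>y\<close> is
  proposed; the value there only matters for the set \<open>mh_reject_set\<close> ($A_x$). It has to be 1: with
  the value 0, every \<open>y\<close> with $p(x,y) = 0 < p^*(x,y)$ would belong to $A_x$, and
  $\max\{p,p^*\}$ would differ from $p$ on $A_x$ (for instance for the deterministic rotation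
  of three points).\<close>

definition mh_accept :: "('a \<Rightarrow> real) \<Rightarrow> ('a \<Rightarrow> 'a \<Rightarrow> real) \<Rightarrow> 'a \<Rightarrow> 'a \<Rightarrow> real" where
  "mh_accept \<pi>d p x y =
     (if \<pi>d x * p x y > 0 then min (\<pi>d y * p y x / (\<pi>d x * p x y)) 1 else 1)"

definition mh_reject_set :: "'a measure \<Rightarrow> ('a \<Rightarrow> real) \<Rightarrow> ('a \<Rightarrow> 'a \<Rightarrow> real) \<Rightarrow> 'a \<Rightarrow> 'a set" where
  "mh_reject_set \<mu> \<pi>d p x = {y \<in> space \<mu>. mh_accept \<pi>d p x y < 1}"

definition mh_reject_prob :: "'a measure \<Rightarrow> ('a \<Rightarrow> real) \<Rightarrow> ('a \<Rightarrow> 'a \<Rightarrow> real) \<Rightarrow> 'a \<Rightarrow> real" where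
  "mh_reject_prob \<mu> \<pi>d p x = (LINT y:(space \<mu> - {x})|\<mu>. (1 - mh_accept \<pi>d p x y) * p x y)"

definition mh1_kernel where
  "mh1_kernel \<mu> \<pi>d p ps =
     density_atom_kernel \<mu> (\<lambda>x y. min (p x y) (ps x y)) (mh_reject_prob \<mu> \<pi>d p)"

definition mh1_op where
  "mh1_op \<mu> \<pi>d p ps =
     density_atom_op \<mu> (\<lambda>x y. min (p x y) (ps x y)) (mh_reject_prob \<mu> \<pi>d p)"

definition mh2_kernel where
  "mh2_kernel \<mu> \<pi>d p ps =
     density_atom_kernel \<mu> (\<lambda>x y. max (p x y) (ps x y)) (\<lambda>x. - mh_reject_prob \<mu> \<pi>d p x)"

definition mh2_op where
  "mh2_op \<mu> \<pi>d p ps =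
     density_atom_op \<mu> (\<lambda>x y. max (p x y) (ps x y)) (\<lambda>x. - mh_reject_prob \<mu> \<pi>d p x)"

end

theory Submission
  imports Defs
begin

text \<open>Each spectral integral in the claim is a Metropolis-Hastings kernel in disguise. The operators
  $\int \lambda\,\mathcal E_i(d\lambda)$ and $M_i$ have the same quadratic form, and over the complex
  numbers a bounded operator is determined by its quadratic form
  (\<open>bounded_op_eq_if_quadratic_form_eq\<close>). Hence \<open>spectral_value\<close> at \<open>C\<close> is just
  $M_i(x,C)$ (\<open>spectral_value_density_atom_op\<close>).

  What remains compares densities. The identity $\alpha_1 p = \min\{p,p^*\}$ shows that,
  almost everywhere, $\min\{p,p^*\}$ is $p$ off $A_x$ and $p^*$ on $A_x$, and that $\max\{p,p^*\}$ is the other one. Away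
  from \<open>x\<close> the atoms do not contribute, so integrating the density that equals $p$ (or $p^*$) on each
  part of \<open>B\<close> gives the first and third formula. At \<open>x\<close> the two atoms cancel, and
  $\min\{p,p^*\} + \max\{p,p^*\} = p + p^*$ gives
  $M_1(x,\{x\}) + M_2(x,\{x\}) = P(x,\{x\}) + P^*(x,\{x\})$. The two terms on the right agree: by
  reversal on the rectangle $\{x\} \times \{x\}$ if $\pi\{x\} > 0$, and because
  $\mu\{x\} = 0$ otherwise (\<open>time_reversal_singleton_eq\<close>).\<close>

section \<open>Operators determined by their quadratic form\<close>

lemma L2_lincomb:
  assumes "f \<in> L2 M" "g \<in> L2 M"
  shows "(\<lambda>x. a * f x + g x) \<in> L2 M"
proof -
  have [measurable]: "f \<in> borel_measurable M" "g \<in> borel_measurable M"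
    and i: "integrable M (\<lambda>x. (cmod (f x))\<^sup>2)" "integrable M (\<lambda>x. (cmod (g x))\<^sup>2)"
    using assms by (auto simp: L2_def)
  have le: "(cmod (a * f x + g x))\<^sup>2 \<le> 2 * (cmod a)\<^sup>2 * (cmod (f x))\<^sup>2 + 2 * (cmod (g x))\<^sup>2" for x
  proof -
    have "(cmod (a * f x + g x))\<^sup>2 \<le> (cmod a * cmod (f x) + cmod (g x))\<^sup>2"
      by (intro power_mono) (auto simp: norm_mult[symmetric] norm_triangle_ineq)
    also have "\<dots> \<le> 2 * (cmod a * cmod (f x))\<^sup>2 + 2 * (cmod (g x))\<^sup>2"
      using zero_le_power2[of "cmod a * cmod (f x) - cmod (g x)"]
      by (simp add: power2_sum power2_diff)
    finally show ?thesis by (simp add: power_mult_distrib)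
  qed
  have "integrable M (\<lambda>x. (cmod (a * f x + g x))\<^sup>2)"
    by (rule Bochner_Integration.integrable_bound
        [of M "\<lambda>x. 2 * (cmod a)\<^sup>2 * (cmod (f x))\<^sup>2 + 2 * (cmod (g x))\<^sup>2"])
      (use i le in \<open>auto intro!: AE_I2\<close>)
  then show ?thesis by (auto simp: L2_def)
qed

lemma integrable_L2_mult_cnj:
  assumes "f \<in> L2 M" "g \<in> L2 M"
  shows "integrable M (\<lambda>x. f x * cnj (g x))"
proof -
  have [measurable]: "f \<in> borel_measurable M" "g \<in> borel_measurable M"
    and i: "integrable M (\<lambda>x. (cmod (f x))\<^sup>2)" "integrable M (\<lambda>x. (cmod (g x))\<^sup>2)"
    using assms by (auto simp: L2_def)
  have le: "cmod (f x * cnj (g x)) \<le> (cmod (f x))\<^sup>2 + (cmod (g x))\<^sup>2" for x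
    using zero_le_power2[of "cmod (f x) - cmod (g x)"] zero_le_power2[of "cmod (f x)"]
      zero_le_power2[of "cmod (g x)"]
    by (simp only: norm_mult complex_mod_cnj power2_diff)
  have [measurable]: "(\<lambda>x. cnj (g x)) \<in> borel_measurable M"
    by (intro borel_measurable_continuous_on[OF continuous_on_cnj[OF continuous_on_id]]) fact
  show ?thesis
    by (rule Bochner_Integration.integrable_bound
        [of M "\<lambda>x. (cmod (f x))\<^sup>2 + (cmod (g x))\<^sup>2"])
      (use i le in \<open>auto intro!: AE_I2\<close>)
qed

lemma bounded_op_L2:
  "bounded_op M T \<Longrightarrow> f \<in> L2 M \<Longrightarrow> T f \<in> L2 M"
  by (auto simp: bounded_op_def)

lemma L2_inner_bounded_op_lincomb:
  assumes T: "bounded_op M T" and f: "f \<in> L2 M" and g: "g \<in> L2 M"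
  shows "L2_inner M (T (\<lambda>x. a * f x + g x)) (\<lambda>x. a * f x + g x) =
    a * cnj a * L2_inner M (T f) f + a * L2_inner M (T f) g
    + cnj a * L2_inner M (T g) f + L2_inner M (T g) g"
proof -
  let ?h = "\<lambda>x. a * f x + g x"
  note L = bounded_op_L2[OF T f] bounded_op_L2[OF T g] bounded_op_L2[OF T L2_lincomb[OF f g]]
  note I = integrable_L2_mult_cnj[OF L(1) f] integrable_L2_mult_cnj[OF L(1) g]
    integrable_L2_mult_cnj[OF L(2) f] integrable_L2_mult_cnj[OF L(2) g]
  have lin: "AE x in M. T ?h x = a * T f x + T g x"
    using T f g by (auto simp: bounded_op_def)
  have meas: "(\<lambda>x. T ?h x * cnj (?h x)) \<in> borel_measurable M"
    by (rule borel_measurable_integrable[OF integrable_L2_mult_cnj[OF L(3) L2_lincomb[OF f g]]])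
  have "L2_inner M (T ?h) ?h = (\<integral>x. a * cnj a * (T f x * cnj (f x)) + a * (T f x * cnj (g x))
      + cnj a * (T g x * cnj (f x)) + T g x * cnj (g x) \<partial>M)"
    unfolding L2_inner_def
  proof (rule integral_cong_AE[OF meas])
    show "(\<lambda>x. a * cnj a * (T f x * cnj (f x)) + a * (T f x * cnj (g x))
        + cnj a * (T g x * cnj (f x)) + T g x * cnj (g x)) \<in> borel_measurable M"
      by (intro borel_measurable_integrable Bochner_Integration.integrable_add
          integrable_mult_right I)
    show "AE x in M. T ?h x * cnj (?h x) = a * cnj a * (T f x * cnj (f x)) + a * (T f x * cnj (g x))
        + cnj a * (T g x * cnj (f x)) + T g x * cnj (g x)"
      using lin by eventually_elim (simp add: algebra_simps)
  qed
  also have "\<dots> = a * cnj a * L2_inner M (T f) f + a * L2_inner M (T f) g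
    + cnj a * L2_inner M (T g) f + L2_inner M (T g) g"
    unfolding L2_inner_def using I by (simp add: Bochner_Integration.integral_add)
  finally show ?thesis .
qed

text \<open>Polarization. For every scalar \<open>a\<close>, comparing the forms of \<open>S\<close> and \<open>T\<close> at \<open>a f + g\<close> leaves
  $a X + \bar a Y = 0$, where $X = \langle (S-T)f,g\rangle$ and $Y = \langle (S-T)g,f\rangle$.
  The scalars \<open>1\<close> and \<open>\<i>\<close> force $X = 0$, and \<open>g\<close> may be $(S-T)f$.\<close>

lemma bounded_op_eq_if_quadratic_form_eq:
  assumes S: "bounded_op M S" and T: "bounded_op M T"
    and eq: "\<And>f. f \<in> L2 M \<Longrightarrow> L2_inner M (S f) f = L2_inner M (T f) f"
  shows "op_eq M S T"
  unfolding op_eq_def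
proof
  fix f assume f: "f \<in> L2 M"
  define g where "g = (\<lambda>x. (-1) * T f x + S f x)"
  have g: "g \<in> L2 M"
    unfolding g_def by (intro L2_lincomb bounded_op_L2[OF S] bounded_op_L2[OF T] f)
  define X where "X = L2_inner M (S f) g - L2_inner M (T f) g"
  define Y where "Y = L2_inner M (S g) f - L2_inner M (T g) f"
  have XY: "a * X + cnj a * Y = 0" for a
    using L2_inner_bounded_op_lincomb[OF S f g, of a] L2_inner_bounded_op_lincomb[OF T f g, of a]
      eq[OF L2_lincomb[OF f g, of a]] eq[OF f] eq[OF g]
    by (simp add: X_def Y_def algebra_simps)
  have "X = 0"
    using XY[of 1] XY[of \<i>] by (simp add: add_eq_0_iff)
  note ig = integrable_L2_mult_cnj[OF g g]
  have sq: "g x * cnj (g x) = complex_of_real ((cmod (g x))\<^sup>2)" for x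
    by (rule complex_norm_square[symmetric])
  have "X = (\<integral>x. g x * cnj (g x) \<partial>M)"
    unfolding X_def L2_inner_def
    by (subst Bochner_Integration.integral_diff[symmetric])
      (auto intro!: integrable_L2_mult_cnj bounded_op_L2[OF S] bounded_op_L2[OF T] f g
        Bochner_Integration.integral_cong simp: g_def algebra_simps)
  also have "\<dots> = complex_of_real (\<integral>x. (cmod (g x))\<^sup>2 \<partial>M)"
    unfolding sq by (rule integral_complex_of_real)
  finally have "(\<integral>x. (cmod (g x))\<^sup>2 \<partial>M) = 0"
    using \<open>X = 0\<close> by simp
  then have "AE x in M. (cmod (g x))\<^sup>2 = 0"
    using g by (subst (asm) integral_nonneg_eq_0_iff_AE) (auto simp: L2_def)
  then show "AE x in M. S f x = T f x"
    by eventually_elim (simp add: g_def)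
qed

lemma spectral_integral_eq:
  assumes "is_spectral_integral M E S T"
  shows "op_eq M (spectral_integral M E S) T"
proof -
  have "is_spectral_integral M E S (spectral_integral M E S)"
    unfolding spectral_integral_def using assms by (rule someI[where P = "is_spectral_integral M E S"])
  then show ?thesis
    using assms by (intro bounded_op_eq_if_quadratic_form_eq) (auto simp: is_spectral_integral_def)
qed

lemma density_atom_op_indicator:
  "density_atom_op \<mu> k c (indicator C) x = complex_of_real (density_atom_kernel \<mu> k c x C)"
proof -
  have "(\<integral>y. indicator C y * complex_of_real (k x y) \<partial>\<mu>) =
      (\<integral>y. complex_of_real (indicator C y *\<^sub>R k x y) \<partial>\<mu>)"
    by (intro Bochner_Integration.integral_cong) (auto simp: indicator_def)
  also have "\<dots> = complex_of_real (LINT y:C|\<mu>. k x y)"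
    by (simp only: integral_complex_of_real set_lebesgue_integral_def)
  finally show ?thesis
    by (simp add: density_atom_op_def density_atom_kernel_def indicator_def)
qed

lemma (in finite_measure) indicator_in_L2:
  assumes "C \<in> sets M"
  shows "indicator C \<in> L2 M"
proof -
  have [measurable]: "C \<in> sets M" by fact
  show ?thesis
    by (auto simp: L2_def intro!: integrable_const_bound[of _ 1] AE_I2 split: split_indicator)
qed

text \<open>The spectral integral is almost everywhere the operator of the kernel, so \<open>y \<mapsto> K y C\<close> is a
  version of its value at the indicator of \<open>C\<close>, and \<open>spectral_value\<close> picks this version.\<close>

lemma spectral_value_density_atom_op:
  assumes "finite_measure M" and "C \<in> sets M"
    and E: "spectral_measure_of M (density_atom_op \<mu> k c) E"
  shows "spectral_value M E (L2_spectrum M (density_atom_op \<mu> k c)) (density_atom_kernel \<mu> k c) x C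
    = density_atom_kernel \<mu> k c x C"
proof -
  interpret finite_measure M by fact
  have "op_eq M (spectral_integral M E (L2_spectrum M (density_atom_op \<mu> k c)))
      (density_atom_op \<mu> k c)"
    using E by (intro spectral_integral_eq) (simp add: spectral_measure_of_def)
  then have "AE y in M. spectral_integral M E (L2_spectrum M (density_atom_op \<mu> k c))
      (indicator C) y = complex_of_real (density_atom_kernel \<mu> k c y C)"
    using indicator_in_L2[OF \<open>C \<in> sets M\<close>]
    by (auto simp: op_eq_def density_atom_op_indicator)
  then show ?thesis
    by (simp add: spectral_value_def)
qed

section \<open>Holding probabilities under time reversal\<close>

text \<open>If $\pi\{x\} > 0$, reversal on the rectangle $\{x\} \times \{x\}$ gives
  $\pi\{x\}\,P^*(x,\{x\}) = \pi\{x\}\,P(x,\{x\})$. A null atom of \<open>\<pi>\<close> must be charged by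
  neither kernel, which absolute continuity provides in the application.\<close>

lemma time_reversal_singleton_eq:
  assumes "finite_measure \<pi>" and rev: "time_reversal \<pi> P Ps" and x: "{x} \<in> sets \<pi>"
    and null: "{x} \<in> null_sets \<pi> \<Longrightarrow> emeasure (P x) {x} = 0 \<and> emeasure (Ps x) {x} = 0"
  shows "emeasure (Ps x) {x} = emeasure (P x) {x}"
proof (cases "{x} \<in> null_sets \<pi>")
  case True
  then show ?thesis using null by simp
next
  case False
  interpret finite_measure \<pi> by fact
  have val: "(\<integral>\<^sup>+y\<in>{x}. h y \<partial>\<pi>) = h x * emeasure \<pi> {x}" for h :: "'a \<Rightarrow> ennreal"
  proof -
    have "(\<integral>\<^sup>+y\<in>{x}. h y \<partial>\<pi>) = (\<integral>\<^sup>+y. h x * indicator {x} y \<partial>\<pi>)"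
      by (intro nn_integral_cong) (auto split: split_indicator)
    then show ?thesis using x by (simp add: nn_integral_cmult_indicator)
  qed
  have "emeasure (Ps x) {x} * emeasure \<pi> {x} = emeasure (P x) {x} * emeasure \<pi> {x}"
    using rev[unfolded time_reversal_def, rule_format, OF x x] by (simp only: val)
  moreover have "emeasure \<pi> {x} \<noteq> 0" "emeasure \<pi> {x} \<noteq> \<top>"
    using False x by auto
  ultimately show ?thesis
    by (metis ennreal_mult_cancel_left mult.commute)
qed

section \<open>The acceptance probability and the densities\<close>

text \<open>When $\alpha_1(x,y) < 1$, the move is proposed, so $p(x,y) > 0$ and
  $\min\{p,p^*\} = \alpha_1 p < p$. When $\alpha_1(x,y) = 1$, $\min\{p,p^*\} = p$.\<close>

lemma mh_accept_min_max:
  assumes "0 \<le> \<pi>d x" and "0 \<le> p x y"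
    and eq: "mh_accept \<pi>d p x y * p x y = min (p x y) q"
  shows "mh_accept \<pi>d p x y < 1 \<Longrightarrow> min (p x y) q = q \<and> max (p x y) q = p x y"
    and "\<not> mh_accept \<pi>d p x y < 1 \<Longrightarrow> min (p x y) q = p x y \<and> max (p x y) q = q"
proof -
  assume a: "mh_accept \<pi>d p x y < 1"
  then have "0 < p x y"
    using assms(1,2) by (auto simp: mh_accept_def zero_less_mult_iff split: if_splits)
  then have "mh_accept \<pi>d p x y * p x y < p x y"
    using a by simp
  then show "min (p x y) q = q \<and> max (p x y) q = p x y"
    using eq by (auto simp: min_def max_def split: if_splits)
next
  assume "\<not> mh_accept \<pi>d p x y < 1"
  then have "mh_accept \<pi>d p x y = 1"
    by (auto simp: mh_accept_def split: if_splits)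
  then show "min (p x y) q = p x y \<and> max (p x y) q = q"
    using eq by (auto simp: min_def max_def split: if_splits)
qed

lemma mh_reject_set_measurable:
  assumes [measurable]: "(\<lambda>(x, y). p x y) \<in> borel_measurable (\<mu> \<Otimes>\<^sub>M \<mu>)" "\<pi>d \<in> borel_measurable \<mu>"
    and [measurable]: "x \<in> space \<mu>"
  shows "mh_reject_set \<mu> \<pi>d p x \<in> sets \<mu>"
  unfolding mh_reject_set_def mh_accept_def by measurable

lemma prob_space_density_integral:
  assumes "prob_space (density \<mu> (\<lambda>y. ennreal (q y)))" and q: "q \<in> borel_measurable \<mu>"
    and nn: "\<And>y. y \<in> space \<mu> \<Longrightarrow> 0 \<le> q y"
  shows "integrable \<mu> q"
    and "C \<in> sets \<mu> \<Longrightarrow> measure (density \<mu> (\<lambda>y. ennreal (q y))) C = (LINT y:C|\<mu>. q y)"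
proof -
  interpret prob_space "density \<mu> (\<lambda>y. ennreal (q y))" by fact
  have "(\<integral>\<^sup>+y. ennreal (q y) \<partial>\<mu>) = 1"
    using emeasure_space_1 q
    by (simp add: emeasure_density cong: nn_integral_cong)
  then show i: "integrable \<mu> q"
    using q nn by (intro integrableI_nonneg) (auto intro!: AE_I2)
  assume C: "C \<in> sets \<mu>"
  have "emeasure (density \<mu> (\<lambda>y. ennreal (q y))) C = (\<integral>\<^sup>+y. ennreal (indicator C y *\<^sub>R q y) \<partial>\<mu>)"
    using C q by (subst emeasure_density) (auto intro!: nn_integral_cong split: split_indicator)
  also have "\<dots> = ennreal (LINT y:C|\<mu>. q y)"
    unfolding set_lebesgue_integral_def
    by (intro nn_integral_eq_integral integrable_mult_indicator[OF C i])
      (auto intro!: AE_I2 nn split: split_indicator)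
  finally show "measure (density \<mu> (\<lambda>y. ennreal (q y))) C = (LINT y:C|\<mu>. q y)"
    unfolding measure_def using nn
    by (simp add: set_lebesgue_integral_def Bochner_Integration.integral_nonneg)
qed

text \<open>A density may be replaced by \<open>g\<close> on \<open>A\<close> and by \<open>h\<close> off \<open>A\<close> as long as it agrees with them
  almost everywhere there.\<close>

lemma set_integral_split_AE:
  fixes q g h :: "'a \<Rightarrow> real"
  assumes q: "integrable \<mu> q" and g: "g \<in> borel_measurable \<mu>" and h: "h \<in> borel_measurable \<mu>"
    and B: "B \<in> sets \<mu>" and A: "A \<in> sets \<mu>"
    and on: "AE y in \<mu>. y \<in> A \<longrightarrow> g y = q y" and off: "AE y in \<mu>. y \<notin> A \<longrightarrow> h y = q y"
  shows "(LINT y:B|\<mu>. q y) = (LINT y:(B \<inter> (space \<mu> - A))|\<mu>. h y) + (LINT y:(B \<inter> A)|\<mu>. g y)"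
proof -
  have [measurable]: "B \<in> sets \<mu>" "A \<in> sets \<mu>" "q \<in> borel_measurable \<mu>"
    "g \<in> borel_measurable \<mu>" "h \<in> borel_measurable \<mu>"
    using assms by auto
  have B_eq: "B = (B \<inter> (space \<mu> - A)) \<union> (B \<inter> A)"
    using sets.sets_into_space[OF B] by auto
  have int: "set_integrable \<mu> C q" if "C \<in> sets \<mu>" for C
    unfolding set_integrable_def using integrable_mult_indicator[OF that q] by simp
  have "(LINT y:B|\<mu>. q y) = (LINT y:((B \<inter> (space \<mu> - A)) \<union> (B \<inter> A))|\<mu>. q y)"
    using B_eq by simp
  also have "\<dots> = (LINT y:(B \<inter> (space \<mu> - A))|\<mu>. q y) + (LINT y:(B \<inter> A)|\<mu>. q y)"
    by (intro set_integral_Un int) auto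
  also have "(LINT y:(B \<inter> (space \<mu> - A))|\<mu>. q y) = (LINT y:(B \<inter> (space \<mu> - A))|\<mu>. h y)"
    unfolding set_lebesgue_integral_def
    by (rule integral_cong_AE) (use off in \<open>auto split: split_indicator elim!: eventually_mono\<close>)
  also have "(LINT y:(B \<inter> A)|\<mu>. q y) = (LINT y:(B \<inter> A)|\<mu>. g y)"
    unfolding set_lebesgue_integral_def
    by (rule integral_cong_AE) (use on in \<open>auto split: split_indicator elim!: eventually_mono\<close>)
  finally show ?thesis .
qed

section \<open>Recovering a Markov kernel from the spectral measures of its Metropolis-Hastings kernels\<close>

theorem theorem4p1:
  fixes \<mu> \<pi> :: "'a measure"
    and P Ps :: "'a \<Rightarrow> 'a measure"
    and p ps :: "'a \<Rightarrow> 'a \<Rightarrow> real"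
    and \<pi>d :: "'a \<Rightarrow> real"
    and E1 E2 :: "complex set \<Rightarrow> 'a op"
  assumes singletons: "\<And>x. x \<in> space \<mu> \<Longrightarrow> {x} \<in> sets \<mu>"
    and kernel_P: "P \<in> \<mu> \<rightarrow>\<^sub>M prob_algebra \<mu>"
    and irreducible_P: "phi_irreducible \<mu> P"
    and prob_pi: "prob_space \<pi>"
    and stationary: "\<pi> \<bind> P = \<pi>"
    and kernel_Ps: "Ps \<in> \<mu> \<rightarrow>\<^sub>M prob_algebra \<mu>"
    and reversal: "time_reversal \<pi> P Ps"
    and meas_p: "(\<lambda>(x, y). p x y) \<in> borel_measurable (\<mu> \<Otimes>\<^sub>M \<mu>)"
    and meas_ps: "(\<lambda>(x, y). ps x y) \<in> borel_measurable (\<mu> \<Otimes>\<^sub>M \<mu>)"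
    and meas_pi: "\<pi>d \<in> borel_measurable \<mu>"
    and nonneg_p: "\<And>x y. x \<in> space \<mu> \<Longrightarrow> y \<in> space \<mu> \<Longrightarrow> 0 \<le> p x y"
    and nonneg_ps: "\<And>x y. x \<in> space \<mu> \<Longrightarrow> y \<in> space \<mu> \<Longrightarrow> 0 \<le> ps x y"
    and nonneg_pi: "\<And>x. x \<in> space \<mu> \<Longrightarrow> 0 \<le> \<pi>d x"
    and density_P: "\<And>x. x \<in> space \<mu> \<Longrightarrow> P x = density \<mu> (\<lambda>y. ennreal (p x y))"
    and density_Ps: "\<And>x. x \<in> space \<mu> \<Longrightarrow> Ps x = density \<mu> (\<lambda>y. ennreal (ps x y))"
    and density_pi: "\<pi> = density \<mu> (\<lambda>y. ennreal (\<pi>d y))"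
    and null_pi: "{x \<in> space \<mu>. \<pi>d x = 0} \<in> null_sets \<mu>"
    and accept_min: "\<And>x. x \<in> space \<mu> \<Longrightarrow>
      AE y in \<mu>. mh_accept \<pi>d p x y * p x y = min (p x y) (ps x y)"
    and spectral_E1: "spectral_measure_of \<pi> (mh1_op \<mu> \<pi>d p ps) E1"
    and spectral_E2: "spectral_measure_of \<pi> (mh2_op \<mu> \<pi>d p ps) E2"
  shows "\<forall>x\<in>space \<mu>. \<forall>B\<in>sets \<mu>. x \<notin> B \<longrightarrow>
    (let A = mh_reject_set \<mu> \<pi>d p x;
         I1 = spectral_value \<pi> E1 (L2_spectrum \<pi> (mh1_op \<mu> \<pi>d p ps)) (mh1_kernel \<mu> \<pi>d p ps) x;
         I2 = spectral_value \<pi> E2 (L2_spectrum \<pi> (mh2_op \<mu> \<pi>d p ps)) (mh2_kernel \<mu> \<pi>d p ps) x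
     in measure (P x) B = I1 (B \<inter> (space \<mu> - A)) + I2 (B \<inter> A) \<and>
        measure (P x) {x} = (I1 {x} + I2 {x}) / 2 \<and>
        measure (Ps x) B = I1 (B \<inter> A) + I2 (B \<inter> (space \<mu> - A)))"
proof (intro ballI impI)
  fix x B assume x: "x \<in> space \<mu>" and B: "B \<in> sets \<mu>" and xB: "x \<notin> B"
  define A where "A = mh_reject_set \<mu> \<pi>d p x"
  have A: "A \<in> sets \<mu>"
    unfolding A_def by (rule mh_reject_set_measurable[OF meas_p meas_pi x])
  have [measurable]: "(\<lambda>(x, y). p x y) \<in> borel_measurable (\<mu> \<Otimes>\<^sub>M \<mu>)"
    "(\<lambda>(x, y). ps x y) \<in> borel_measurable (\<mu> \<Otimes>\<^sub>M \<mu>)" "\<pi>d \<in> borel_measurable \<mu>" "x \<in> space \<mu>"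
    by fact+
  have px: "p x \<in> borel_measurable \<mu>" and psx: "ps x \<in> borel_measurable \<mu>"
    by measurable
  interpret \<pi>: prob_space \<pi> by (rule prob_pi)
  have sets_pi: "sets \<pi> = sets \<mu>"
    by (simp add: density_pi)
  have prob_P: "prob_space (density \<mu> (\<lambda>y. ennreal (p x y)))"
    using measurable_space[OF kernel_P x] density_P[OF x] by (simp add: space_prob_algebra)
  have prob_Ps: "prob_space (density \<mu> (\<lambda>y. ennreal (ps x y)))"
    using measurable_space[OF kernel_Ps x] density_Ps[OF x] by (simp add: space_prob_algebra)
  have ip: "integrable \<mu> (p x)"
    "\<And>C. C \<in> sets \<mu> \<Longrightarrow> measure (P x) C = (LINT y:C|\<mu>. p x y)"
    using prob_space_density_integral[OF prob_P px] nonneg_p[OF x] density_P[OF x] by auto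
  have ips: "integrable \<mu> (ps x)"
    "\<And>C. C \<in> sets \<mu> \<Longrightarrow> measure (Ps x) C = (LINT y:C|\<mu>. ps x y)"
    using prob_space_density_integral[OF prob_Ps psx] nonneg_ps[OF x] density_Ps[OF x] by auto

  let ?I1 = "spectral_value \<pi> E1 (L2_spectrum \<pi> (mh1_op \<mu> \<pi>d p ps)) (mh1_kernel \<mu> \<pi>d p ps) x"
  let ?I2 = "spectral_value \<pi> E2 (L2_spectrum \<pi> (mh2_op \<mu> \<pi>d p ps)) (mh2_kernel \<mu> \<pi>d p ps) x"
  let ?r = "mh_reject_prob \<mu> \<pi>d p x"
  have I1: "?I1 C = (LINT y:C|\<mu>. min (p x y) (ps x y)) + ?r * indicator C x"
    if "C \<in> sets \<mu>" for C
    using that spectral_value_density_atom_op[OF \<pi>.finite_measure_axioms _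
        spectral_E1[unfolded mh1_op_def], of C x]
    by (simp add: sets_pi mh1_op_def mh1_kernel_def density_atom_kernel_def)
  have I2: "?I2 C = (LINT y:C|\<mu>. max (p x y) (ps x y)) - ?r * indicator C x"
    if "C \<in> sets \<mu>" for C
    using that spectral_value_density_atom_op[OF \<pi>.finite_measure_axioms _
        spectral_E2[unfolded mh2_op_def], of C x]
    by (simp add: sets_pi mh2_op_def mh2_kernel_def density_atom_kernel_def)
  have BA: "B \<inter> (space \<mu> - A) \<in> sets \<mu>" "B \<inter> A \<in> sets \<mu>"
    using A B by auto

  have on: "AE y in \<mu>. y \<in> A \<longrightarrow> min (p x y) (ps x y) = ps x y \<and> max (p x y) (ps x y) = p x y"
    using accept_min[OF x] AE_space
  proof eventually_elim
    case (elim y)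
    then show ?case
      using mh_accept_min_max(1)[OF nonneg_pi[OF x] nonneg_p[OF x elim(2)] elim(1)]
      unfolding A_def mh_reject_set_def by blast
  qed
  have off: "AE y in \<mu>. y \<notin> A \<longrightarrow> min (p x y) (ps x y) = p x y \<and> max (p x y) (ps x y) = ps x y"
    using accept_min[OF x] AE_space
  proof eventually_elim
    case (elim y)
    then show ?case
      using mh_accept_min_max(2)[OF nonneg_pi[OF x] nonneg_p[OF x elim(2)] elim(1)]
      unfolding A_def mh_reject_set_def by blast
  qed

  have first: "measure (P x) B = ?I1 (B \<inter> (space \<mu> - A)) + ?I2 (B \<inter> A)"
  proof -
    have "measure (P x) B = (LINT y:(B \<inter> (space \<mu> - A))|\<mu>. min (p x y) (ps x y))
        + (LINT y:(B \<inter> A)|\<mu>. max (p x y) (ps x y))"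
      unfolding ip(2)[OF B] using on off
      by (intro set_integral_split_AE[OF ip(1) _ _ B A]) (auto elim: eventually_mono)
    then show ?thesis using xB BA by (simp add: I1 I2)
  qed
  have third: "measure (Ps x) B = ?I1 (B \<inter> A) + ?I2 (B \<inter> (space \<mu> - A))"
  proof -
    have "measure (Ps x) B = (LINT y:(B \<inter> (space \<mu> - A))|\<mu>. max (p x y) (ps x y))
        + (LINT y:(B \<inter> A)|\<mu>. min (p x y) (ps x y))"
      unfolding ips(2)[OF B] using on off
      by (intro set_integral_split_AE[OF ips(1) _ _ B A]) (auto elim: eventually_mono)
    then show ?thesis using xB BA by (simp add: I1 I2)
  qed

  have sx: "{x} \<in> sets \<mu>" by (rule singletons[OF x])
  have null: "emeasure (P x) {x} = 0 \<and> emeasure (Ps x) {x} = 0" if "{x} \<in> null_sets \<pi>"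
  proof -
    \<comment> \<open>\<open>\<mu>\<close> is absolutely continuous with respect to \<open>\<pi>\<close>, because \<open>\<pi>d\<close> vanishes only on a null set.\<close>
    have "AE y in \<mu>. y \<in> {x} \<longrightarrow> ennreal (\<pi>d y) = 0"
      using that unfolding density_pi by (subst (asm) null_sets_density_iff) auto
    moreover have "AE y in \<mu>. y \<notin> {y \<in> space \<mu>. \<pi>d y = 0}"
      using null_pi by (rule AE_not_in)
    ultimately have "AE y in \<mu>. y \<notin> {x}"
      using AE_space
      by eventually_elim (use nonneg_pi in \<open>force simp: ennreal_eq_0_iff\<close>)
    then have "{x} \<in> null_sets \<mu>"
      using sx by (simp add: AE_iff_null_sets)
    then have "{x} \<in> null_sets (P x)" "{x} \<in> null_sets (Ps x)"
      using absolutely_continuousI_density[of "\<lambda>y. ennreal (p x y)" \<mu>]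
        absolutely_continuousI_density[of "\<lambda>y. ennreal (ps x y)" \<mu>] px psx
      unfolding density_P[OF x] density_Ps[OF x] absolutely_continuous_def by auto
    then show ?thesis by auto
  qed
  have hold: "measure (Ps x) {x} = measure (P x) {x}"
    unfolding measure_def
    using time_reversal_singleton_eq[OF \<pi>.finite_measure_axioms reversal _ null] sx sets_pi by simp
  have second: "measure (P x) {x} = (?I1 {x} + ?I2 {x}) / 2"
  proof -
    have int: "set_integrable \<mu> {x} q" if "integrable \<mu> q" for q :: "'a \<Rightarrow> real"
      unfolding set_integrable_def using integrable_mult_indicator[OF sx that] by simp
    have "?I1 {x} + ?I2 {x} = (LINT y:{x}|\<mu>. min (p x y) (ps x y) + max (p x y) (ps x y))"
      using int[OF integrable_min[OF ip(1) ips(1)]] int[OF integrable_max[OF ip(1) ips(1)]]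
      by (simp add: I1[OF sx] I2[OF sx] set_integral_add)
    also have "\<dots> = (LINT y:{x}|\<mu>. p x y + ps x y)"
      by (intro arg_cong[where f = "set_lebesgue_integral \<mu> {x}"] ext) (simp add: min_def max_def)
    also have "\<dots> = measure (P x) {x} + measure (Ps x) {x}"
      using int[OF ip(1)] int[OF ips(1)] by (simp add: ip(2)[OF sx] ips(2)[OF sx] set_integral_add)
    finally show ?thesis using hold by simp
  qed

  show "let A = mh_reject_set \<mu> \<pi>d p x; I1 = ?I1; I2 = ?I2
     in measure (P x) B = I1 (B \<inter> (space \<mu> - A)) + I2 (B \<inter> A) \<and>
        measure (P x) {x} = (I1 {x} + I2 {x}) / 2 \<and>
        measure (Ps x) B = I1 (B \<inter> A) + I2 (B \<inter> (space \<mu> - A))"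
    unfolding Let_def A_def[symmetric] using first second third by blast
qed

end
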